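(* Let $S\subset\mathbb{R}$ be a bounded set with at least two elements, and let $\operatorname{diam}(S)=\sup_{s,s'\in S}|s-s'|$. Then for all $n\in\mathbb{N}$ and all integers $m>4n(3n+1)$, $$g\big[\mathbf{CP}_m(S)\big]\ \ge\ \frac{\operatorname{diam}(S)}{2\sup_{s\in S}|s|}\;g\big[\mathbf{CP}_n(\mathbb{R})\big].$$
   Context: For an $n\times n$ complex matrix $A=(a_{i,j})$, Gaussian elimination without pivoting is the recursion $a^{(1)}_{i,j}=a_{i,j}$ and $a^{(k+1)}_{i,j}=a^{(k)}_{i,j}-a^{(k)}_{i,k}a^{(k)}_{k,j}/a^{(k)}_{k,k}$ for $k+1\le i,j\le n$, $k=1,\dots,n-1$ (defined when all pivots are nonzero). Growth factor: $g(A)=\max_{i,j,k}|a^{(k)}_{i,j}|/\max_{i,j}|a_{i,j}|$; for a set $\mathbf{X}$ of matrices, $g[\mathbf{X}]=\sup_{A\in\mathbf{X}}g(A)$. For $S\subseteq\mathbb{C}$, $\mathbf{CP}_n(S)$ is the set of invertible $A\in S^{n\times n}$ (entries of the input matrix in $S$; intermediate iterates need not be in $S$) for which elimination is defined and $|a^{(k)}_{i,j}|\le|a^{(k)}_{k,k}|$ for all $k$ and all $i,j\ge k$. *)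

theory Defs
  imports "HOL-Analysis.Analysis"
begin

text \<open>Square matrices of size n are functions nat => nat => complex; only the
entries with indices in {1..n} are relevant (1-based indexing as in the paper).\<close>

type_synonym cmat = "nat \<Rightarrow> nat \<Rightarrow> complex"

definition det_n :: "nat \<Rightarrow> cmat \<Rightarrow> complex" where
  "det_n n A = (\<Sum>p | p permutes {1..n}. of_int (sign p) * (\<Prod>i\<in>{1..n}. A i (p i)))"

definition invertible_n :: "nat \<Rightarrow> cmat \<Rightarrow> bool" where
  "invertible_n n A \<longleftrightarrow> det_n n A \<noteq> 0"

text \<open>ge_iter A t = a^(t+1) in the paper's notation (a^(1) = A).\<close>
primrec ge_iter :: "cmat \<Rightarrow> nat \<Rightarrow> cmat" where
  "ge_iter A 0 = A"
| "ge_iter A (Suc t) = (\<lambda>i j. ge_iter A t i j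
      - ge_iter A t i (Suc t) * ge_iter A t (Suc t) j / ge_iter A t (Suc t) (Suc t))"

definition ge :: "cmat \<Rightarrow> nat \<Rightarrow> nat \<Rightarrow> nat \<Rightarrow> complex" where
  "ge A k i j = ge_iter A (k - 1) i j"

definition ge_defined :: "nat \<Rightarrow> cmat \<Rightarrow> bool" where
  "ge_defined n A \<longleftrightarrow> (\<forall>k\<in>{1..n-1}. ge A k k k \<noteq> 0)"

definition growth_factor :: "nat \<Rightarrow> cmat \<Rightarrow> real" where
  "growth_factor n A =
     Max {cmod (ge A k i j) | k i j. 1 \<le> k \<and> k \<le> n \<and> k \<le> i \<and> i \<le> n \<and> k \<le> j \<and> j \<le> n}
     / Max {cmod (A i j) | i j. i \<in> {1..n} \<and> j \<in> {1..n}}"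

definition growth_sup :: "nat \<Rightarrow> cmat set \<Rightarrow> ereal" where
  "growth_sup n X = (SUP A\<in>X. ereal (growth_factor n A))"

text \<open>CP_n(S): invertible matrices with entries in S for which GE without pivoting is
defined and coincides with complete pivoting.\<close>
definition CP :: "nat \<Rightarrow> complex set \<Rightarrow> cmat set" where
  "CP n S = {A. (\<forall>i\<in>{1..n}. \<forall>j\<in>{1..n}. A i j \<in> S) \<and> invertible_n n A \<and> ge_defined n A \<and>
     (\<forall>k\<in>{1..n}. \<forall>i\<in>{k..n}. \<forall>j\<in>{k..n}. cmod (ge A k i j) \<le> cmod (ge A k k k))}"

end

(* Complete pivoting on a real matrix A can be made strict by damping later rows and columns by
   powers of 1 - 1/(4n), which costs less than a factor 2 of growth. It then survives entrywise errors
   of size 2^-(4n+1), since an elimination step multiplies errors by at most 4, so the entries of A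
   (scaled to [-1,1]) may be truncated to 4n+1 binary digits. Such a dyadic matrix is the Schur
   complement of a 0/1 matrix that is itself completely pivoted: each digit of each column costs
   three rows and columns, in all 3n(4n+1) + n = 4n(3n+1). Finally, a constant first row and column
   with entry b of larger modulus replaces {0,1} by {a,b}, with growth scaled by |a - b|. The factor 2
   lost in the damping is the 2 in the denominator of the theorem. *)

theory Submission
  imports Defs "Jordan_Normal_Form.Determinant"
begin


text \<open>Truncating to a fixed number of digits makes an absolute error, which is harmless only
  if no pivot is small compared with the largest entry. Complete pivoting gives no such lower bound:
  later pivots may be tiny. The elimination is therefore cut down to a window of steps, from a
  smallest pivot among those up to a largest pivot, to that largest pivot. Divided by the modulus of
  its first pivot, the window is a matrix with entries in [-1,1] and all pivots of modulus at least
  1, and its growth is at least that of A.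

  Three labels per digit are the price of halving. A Schur complement of an integer matrix contains
  halves only if the eliminated block has a determinant other than 1 and -1, and size three is the
  smallest at which a 0/1 matrix has such a nonzero determinant.

  The diameter of S need not be attained, so the bound is proved for every pair a, b in S and the
  supremum is taken at the very end.\<close>

section \<open>Elimination along a list of labels: pivoting, scaling, perturbation\<close>

definition schur :: "'a \<Rightarrow> ('a \<Rightarrow> 'a \<Rightarrow> real) \<Rightarrow> 'a \<Rightarrow> 'a \<Rightarrow> real" where
  "schur x M = (\<lambda>i j. M i j - M i x * M x j / M x x)"

text \<open>The order of elimination is a list of arbitrary labels, so that blocks can be put in
  front of an elimination without index arithmetic. The matrix is total, but only its entries on the
  labels of the list count.\<close>

primrec comp_piv :: "'a list \<Rightarrow> ('a \<Rightarrow> 'a \<Rightarrow> real) \<Rightarrow> bool" where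
  "comp_piv [] M \<longleftrightarrow> True"
| "comp_piv (x # xs) M \<longleftrightarrow> M x x \<noteq> 0
     \<and> (\<forall>i\<in>set (x # xs). \<forall>j\<in>set (x # xs). \<bar>M i j\<bar> \<le> \<bar>M x x\<bar>)
     \<and> comp_piv xs (schur x M)"

text \<open>Under complete pivoting the largest iterate is attained at a pivot, so growth is
  witnessed by a single large pivot. A threshold, unlike a maximum, passes easily through scaling,
  perturbation and prepending.\<close>

primrec pivot_ge :: "real \<Rightarrow> 'a list \<Rightarrow> ('a \<Rightarrow> 'a \<Rightarrow> real) \<Rightarrow> bool" where
  "pivot_ge g [] M \<longleftrightarrow> False"
| "pivot_ge g (x # xs) M \<longleftrightarrow> g \<le> \<bar>M x x\<bar> \<or> pivot_ge g xs (schur x M)"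

text \<open>For \<open>\<sigma> = 1\<close> and \<open>\<delta> > 0\<close> this is complete
  pivoting with a lower bound on the pivots; for \<open>\<sigma> < 1\<close> the relative gap can
  absorb errors.\<close>

primrec strict_piv :: "real \<Rightarrow> real \<Rightarrow> 'a list \<Rightarrow> ('a \<Rightarrow> 'a \<Rightarrow> real) \<Rightarrow> bool" where
  "strict_piv \<sigma> \<delta> [] M \<longleftrightarrow> True"
| "strict_piv \<sigma> \<delta> (x # xs) M \<longleftrightarrow> \<delta> \<le> \<bar>M x x\<bar>
     \<and> (\<forall>i\<in>set (x # xs). \<forall>j\<in>set (x # xs). (i, j) \<noteq> (x, x) \<longrightarrow> \<bar>M i j\<bar> \<le> \<sigma> * \<bar>M x x\<bar>)
     \<and> strict_piv \<sigma> \<delta> xs (schur x M)"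

lemma schur_cong:
  assumes "\<forall>i\<in>insert x X. \<forall>j\<in>insert x X. M i j = M' i j" "i \<in> X" "j \<in> X"
  shows "schur x M i j = schur x M' i j"
  using assms by (simp add: schur_def)

lemma comp_piv_cong:
  assumes "\<forall>i\<in>set xs. \<forall>j\<in>set xs. M i j = M' i j"
  shows "comp_piv xs M \<longleftrightarrow> comp_piv xs M'"
  using assms
proof (induction xs arbitrary: M M')
  case (Cons x xs)
  have "comp_piv xs (schur x M) \<longleftrightarrow> comp_piv xs (schur x M')"
    using Cons.prems by (intro Cons.IH ballI schur_cong[of x "set xs"]) auto
  then show ?case using Cons.prems by simp
qed simp

lemma pivot_ge_cong:
  assumes "\<forall>i\<in>set xs. \<forall>j\<in>set xs. M i j = M' i j"
  shows "pivot_ge g xs M \<longleftrightarrow> pivot_ge g xs M'"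
  using assms
proof (induction xs arbitrary: M M')
  case (Cons x xs)
  have "pivot_ge g xs (schur x M) \<longleftrightarrow> pivot_ge g xs (schur x M')"
    using Cons.prems by (intro Cons.IH ballI schur_cong[of x "set xs"]) auto
  then show ?case using Cons.prems by simp
qed simp

lemma pivot_ge_mono: "pivot_ge g xs M \<Longrightarrow> g' \<le> g \<Longrightarrow> pivot_ge g' xs M"
  by (induction xs arbitrary: M) auto

lemma comp_piv_map: "comp_piv (map f xs) M \<longleftrightarrow> comp_piv xs (\<lambda>i j. M (f i) (f j))"
proof (induction xs arbitrary: M)
  case (Cons x xs)
  have "(\<lambda>i j. schur (f x) M (f i) (f j)) = schur x (\<lambda>i j. M (f i) (f j))"
    by (simp add: schur_def)
  with Cons show ?case by simp
qed simp

lemma pivot_ge_map: "pivot_ge g (map f xs) M \<longleftrightarrow> pivot_ge g xs (\<lambda>i j. M (f i) (f j))"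
proof (induction xs arbitrary: M)
  case (Cons x xs)
  have "(\<lambda>i j. schur (f x) M (f i) (f j)) = schur x (\<lambda>i j. M (f i) (f j))"
    by (simp add: schur_def)
  with Cons show ?case by simp
qed simp

lemma schur_scale: "c \<noteq> 0 \<Longrightarrow> schur x (\<lambda>i j. c * M i j) = (\<lambda>i j. c * schur x M i j)"
  by (simp add: schur_def field_simps)

lemma comp_piv_scale: "c \<noteq> 0 \<Longrightarrow> comp_piv xs M \<Longrightarrow> comp_piv xs (\<lambda>i j. c * M i j)"
  by (induction xs arbitrary: M) (simp_all add: schur_scale abs_mult)

lemma pivot_ge_scale: "c \<noteq> 0 \<Longrightarrow> pivot_ge g xs M \<Longrightarrow> pivot_ge (\<bar>c\<bar> * g) xs (\<lambda>i j. c * M i j)"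
  by (induction xs arbitrary: M) (auto simp add: schur_scale abs_mult)

lemma schur_diag_scale:
  assumes "\<kappa> \<noteq> 0" "d x \<noteq> 0"
  shows "schur x (\<lambda>i j. \<kappa> * d i * d j * M i j) = (\<lambda>i j. \<kappa> * d i * d j * schur x M i j)"
  using assms by (simp add: schur_def field_simps)

text \<open>Scaling by a diagonal matrix on both sides commutes with elimination, so every iterate
  carries the same weights. An entry other than the pivot has a later row or column label, hence at
  least one more factor \<open>s\<close> than the pivot.\<close>

lemma strict_piv_diag_scale:
  fixes d :: "'a \<Rightarrow> real"
  assumes "strict_piv 1 c xs M" "\<kappa> > 0" "0 \<le> s" "s \<le> 1" "c > 0"
    and "\<And>x. x \<in> set xs \<Longrightarrow> 0 < d x" "\<And>x. x \<in> set xs \<Longrightarrow> \<delta> \<le> \<kappa> * (d x)\<^sup>2 * c"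
    and "sorted_wrt (\<lambda>x y. d y \<le> s * d x) xs"
  shows "strict_piv s \<delta> xs (\<lambda>i j. \<kappa> * d i * d j * M i j)"
  using assms
proof (induction xs arbitrary: M)
  case (Cons x xs)
  have dx: "0 < d x" using Cons.prems by simp
  have "\<delta> \<le> \<bar>\<kappa> * d x * d x * M x x\<bar>"
  proof -
    have "\<delta> \<le> \<kappa> * (d x)\<^sup>2 * c" using Cons.prems by simp
    also have "\<dots> \<le> \<kappa> * (d x)\<^sup>2 * \<bar>M x x\<bar>"
      using Cons.prems by (intro mult_left_mono) auto
    finally show ?thesis using \<open>\<kappa> > 0\<close> dx by (simp add: abs_mult power2_eq_square mult.assoc)
  qed
  moreover have "\<bar>\<kappa> * d i * d j * M i j\<bar> \<le> s * \<bar>\<kappa> * d x * d x * M x x\<bar>"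
    if ij: "i \<in> set (x # xs)" "j \<in> set (x # xs)" "(i, j) \<noteq> (x, x)" for i j
  proof -
    have pos: "0 < d i" "0 < d j" using ij Cons.prems by auto
    have M: "\<bar>M i j\<bar> \<le> \<bar>M x x\<bar>" using Cons.prems(1) ij by auto
    have small: "d y \<le> s * d x" if "y \<in> set xs" for y using Cons.prems that by auto
    have le: "d y \<le> d x" if "y \<in> set (x # xs)" for y
    proof -
      have "s * d x \<le> d x" using \<open>s \<le> 1\<close> dx by simp
      then show ?thesis using that small[of y] by auto
    qed
    have "d i * d j \<le> s * d x * d x"
    proof (cases "i = x")
      case True
      then have "j \<in> set xs" using ij by auto
      then show ?thesis using small[of j] True dx by (simp add: mult.commute mult_left_mono)
    next
      case False
      then have "i \<in> set xs" using ij by auto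
      then show ?thesis using small[of i] le[OF ij(2)] pos dx \<open>0 \<le> s\<close> by (intro mult_mono) auto
    qed
    then have "\<kappa> * (d i * d j) * \<bar>M i j\<bar> \<le> \<kappa> * (s * d x * d x) * \<bar>M x x\<bar>"
      using M pos dx \<open>0 \<le> s\<close> \<open>\<kappa> > 0\<close> by (intro mult_mono[OF mult_left_mono]) auto
    then show ?thesis using pos dx \<open>\<kappa> > 0\<close> by (simp add: abs_mult mult_ac)
  qed
  moreover have "strict_piv s \<delta> xs (\<lambda>i j. \<kappa> * d i * d j * schur x M i j)"
    using Cons.prems by (intro Cons.IH) auto
  ultimately show ?case
    using schur_diag_scale[of \<kappa> d x] \<open>\<kappa> > 0\<close> dx by simp
qed simp

lemma pivot_ge_diag_scale:
  fixes d :: "'a \<Rightarrow> real"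
  assumes "pivot_ge g xs M" "\<kappa> > 0" "g \<ge> 0"
    and "\<And>x. x \<in> set xs \<Longrightarrow> 0 < d x" "\<And>x. x \<in> set xs \<Longrightarrow> \<delta> \<le> \<kappa> * (d x)\<^sup>2"
  shows "pivot_ge (\<delta> * g) xs (\<lambda>i j. \<kappa> * d i * d j * M i j)"
  using assms
proof (induction xs arbitrary: M)
  case (Cons x xs)
  have dx: "0 < d x" using Cons.prems by simp
  show ?case
  proof (cases "g \<le> \<bar>M x x\<bar>")
    case True
    then have "\<delta> * g \<le> \<kappa> * (d x)\<^sup>2 * \<bar>M x x\<bar>"
      using Cons.prems dx by (intro mult_mono) auto
    then show ?thesis using \<open>\<kappa> > 0\<close> dx by (simp add: abs_mult power2_eq_square mult.assoc)
  next
    case False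
    then have "pivot_ge (\<delta> * g) xs (\<lambda>i j. \<kappa> * d i * d j * schur x M i j)"
      using Cons.prems by (intro Cons.IH) auto
    then show ?thesis using schur_diag_scale[of \<kappa> d x] \<open>\<kappa> > 0\<close> dx by simp
  qed
qed simp

text \<open>Both quotients of an entry by the pivot are at most 1, so one elimination step multiplies
  an entrywise error by at most 4.\<close>

lemma schur_perturb:
  assumes "M x x \<noteq> 0" "M' x x \<noteq> 0"
    and "\<bar>M x j\<bar> \<le> \<bar>M x x\<bar>" "\<bar>M' i x\<bar> \<le> \<bar>M' x x\<bar>"
    and "\<bar>M' i j - M i j\<bar> \<le> e" "\<bar>M' i x - M i x\<bar> \<le> e" "\<bar>M' x j - M x j\<bar> \<le> e"
      "\<bar>M' x x - M x x\<bar> \<le> e"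
  shows "\<bar>schur x M' i j - schur x M i j\<bar> \<le> 4 * e"
proof -
  define r where "r = M' i x / M' x x"
  define q where "q = M x j / M x x"
  have r: "\<bar>r\<bar> \<le> 1" using assms by (simp add: r_def)
  have q: "\<bar>q\<bar> \<le> 1" using assms by (simp add: q_def)
  have eq: "schur x M' i j - schur x M i j = (M' i j - M i j) - r * (M' x j - M x j)
       - q * (M' i x - M i x) + r * (q * (M' x x - M x x))"
    using assms(1,2) by (simp add: schur_def r_def q_def field_simps)
  have b: "\<bar>a * b\<bar> \<le> e" if "\<bar>a\<bar> \<le> 1" "\<bar>b\<bar> \<le> e" for a b :: real
    using mult_mono[OF that] by (simp add: abs_mult)
  show ?thesis unfolding eq
    using assms(5) b[OF r assms(7)] b[OF q assms(6)] b[OF r b[OF q assms(8)]] by linarith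
qed

text \<open>The quantity \<open>4 ^ length xs * e\<close> is invariant: a step shortens the list by
  one and replaces \<open>e\<close> by \<open>4 * e\<close>. While a label remains, it gives
  \<open>2 * e \<le> (1 - \<sigma>) * \<delta>\<close>, which is what a step needs, since the pivot
  may shrink by \<open>e\<close> while a competitor grows by \<open>e\<close>.\<close>

lemma strict_piv_perturb:
  assumes "strict_piv \<sigma> \<delta> xs M" "0 < \<sigma>" "\<sigma> \<le> 1" "0 < \<delta>" "0 \<le> e"
    and "\<forall>i\<in>set xs. \<forall>j\<in>set xs. \<bar>M' i j - M i j\<bar> \<le> e"
    and "4 ^ length xs * e \<le> 2 * (1 - \<sigma>) * \<delta>"
  shows "comp_piv xs M' \<and> (pivot_ge g xs M \<longrightarrow> pivot_ge (g - 4 ^ length xs * e) xs M')"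
  using assms
proof (induction xs arbitrary: M M' e)
  case (Cons x xs)
  note [simp del] = power_Suc
  have pow: "(1::real) \<le> 4 ^ length xs" by simp
  have e4: "4 * e \<le> 2 * (1 - \<sigma>) * \<delta>"
  proof -
    have "1 * (4 * e) \<le> 4 ^ length xs * (4 * e)"
      using pow \<open>0 \<le> e\<close> by (intro mult_right_mono) auto
    then show ?thesis using Cons.prems by (simp add: power_Suc mult_ac)
  qed
  have D: "\<delta> \<le> \<bar>M x x\<bar>" using Cons.prems by simp
  have e2: "2 * e \<le> (1 - \<sigma>) * \<bar>M x x\<bar>"
    using e4 mult_left_mono[OF D, of "1 - \<sigma>"] \<open>\<sigma> \<le> 1\<close> by linarith
  have near: "\<bar>M' i j - M i j\<bar> \<le> e" if "i \<in> set (x # xs)" "j \<in> set (x # xs)" for i j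
    using Cons.prems that by blast
  have str: "\<bar>M i j\<bar> \<le> \<sigma> * \<bar>M x x\<bar>" if "i \<in> set (x # xs)" "j \<in> set (x # xs)" "(i, j) \<noteq> (x, x)" for i j
    using Cons.prems(1) that by auto
  have weak: "\<bar>M i j\<bar> \<le> \<bar>M x x\<bar>" if "i \<in> set (x # xs)" "j \<in> set (x # xs)" for i j
  proof (cases "(i, j) = (x, x)")
    case False
    moreover have "\<sigma> * \<bar>M x x\<bar> \<le> \<bar>M x x\<bar>" using \<open>\<sigma> \<le> 1\<close> by (simp add: mult_left_le_one_le \<open>0 < \<sigma>\<close> less_imp_le)
    ultimately show ?thesis using str[OF that] by linarith
  qed auto
  have nx: "\<bar>M' x x - M x x\<bar> \<le> e" using near by simp
  have piv: "\<bar>M' x x\<bar> \<ge> \<bar>M x x\<bar> - e" using nx by linarith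
  have e2': "2 * e \<le> \<bar>M x x\<bar> - \<sigma> * \<bar>M x x\<bar>" using e2 by (simp add: algebra_simps)
  have "\<sigma> * \<bar>M x x\<bar> > 0" using D \<open>0 < \<delta>\<close> \<open>0 < \<sigma>\<close> by simp
  then have nz: "M' x x \<noteq> 0" using piv e2' \<open>0 \<le> e\<close> by linarith
  have bd: "\<bar>M' i j\<bar> \<le> \<bar>M' x x\<bar>" if ij: "i \<in> set (x # xs)" "j \<in> set (x # xs)" for i j
  proof (cases "(i, j) = (x, x)")
    case False
    show ?thesis using str[OF ij False] near[OF ij] piv e2' by linarith
  qed auto
  have IH: "comp_piv xs (schur x M') \<and> (pivot_ge g xs (schur x M) \<longrightarrow>
      pivot_ge (g - 4 ^ length xs * (4 * e)) xs (schur x M'))"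
  proof (rule Cons.IH)
    show "\<forall>i\<in>set xs. \<forall>j\<in>set xs. \<bar>schur x M' i j - schur x M i j\<bar> \<le> 4 * e"
      using nz D \<open>0 < \<delta>\<close> by (intro ballI schur_perturb weak bd near) auto
  qed (use Cons.prems in \<open>auto simp: power_Suc mult_ac\<close>)
  have "e \<le> 4 ^ length (x # xs) * e"
    using mult_right_mono[of 1 "4 ^ length (x # xs)" e] \<open>0 \<le> e\<close> by simp
  then have "g \<le> \<bar>M x x\<bar> \<Longrightarrow> g - 4 ^ length (x # xs) * e \<le> \<bar>M' x x\<bar>"
    using piv by linarith
  then show ?case using nz bd IH by (auto simp: power_Suc mult_ac)
qed simp


section \<open>Indexed elimination, LU factorization and the determinant\<close>

primrec schur_iter :: "(nat \<Rightarrow> nat \<Rightarrow> real) \<Rightarrow> nat \<Rightarrow> nat \<Rightarrow> nat \<Rightarrow> real" where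
  "schur_iter R 0 = R"
| "schur_iter R (Suc t) = schur (Suc t) (schur_iter R t)"

lemma ge_iter_of_real:
  assumes "\<forall>i\<in>{1..n}. \<forall>j\<in>{1..n}. A i j = of_real (R i j)"
    and "t \<le> n" "i \<in> {1..n}" "j \<in> {1..n}"
  shows "ge_iter A t i j = of_real (schur_iter R t i j)"
  using assms(2-)
proof (induction t arbitrary: i j)
  case (Suc t)
  then show ?case by (simp add: schur_def)
qed (use assms(1) in simp)

lemma comp_piv_schur_iter:
  assumes "comp_piv [1..<Suc m] R" "t \<le> m"
  shows "comp_piv [Suc t..<Suc m] (schur_iter R t)"
  using assms(2)
proof (induction t)
  case (Suc t)
  then have "comp_piv (Suc t # [Suc (Suc t)..<Suc m]) (schur_iter R t)"
    by (simp add: upt_conv_Cons del: upt_Suc)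
  then show ?case by (simp del: upt_Suc)
qed (use assms(1) in simp)

lemma comp_piv_schur_iter_bound:
  assumes "comp_piv [1..<Suc m] R" "k \<in> {1..m}" "i \<in> {k..m}" "j \<in> {k..m}"
  shows "schur_iter R (k - 1) k k \<noteq> 0"
    and "\<bar>schur_iter R (k - 1) i j\<bar> \<le> \<bar>schur_iter R (k - 1) k k\<bar>"
proof -
  have "comp_piv [k..<Suc m] (schur_iter R (k - 1))"
    using comp_piv_schur_iter[OF assms(1), of "k - 1"] assms(2) by auto
  moreover have "[k..<Suc m] = k # [Suc k..<Suc m]"
    using assms(2) by (simp add: upt_conv_Cons)
  ultimately have "comp_piv (k # [Suc k..<Suc m]) (schur_iter R (k - 1))" by simp
  moreover have "set (k # [Suc k..<Suc m]) = {k..m}" using assms(2) by auto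
  ultimately have "schur_iter R (k - 1) k k \<noteq> 0 \<and> (\<forall>i\<in>{k..m}. \<forall>j\<in>{k..m}.
      \<bar>schur_iter R (k - 1) i j\<bar> \<le> \<bar>schur_iter R (k - 1) k k\<bar>)"
    unfolding comp_piv.simps by metis
  then show "schur_iter R (k - 1) k k \<noteq> 0"
    and "\<bar>schur_iter R (k - 1) i j\<bar> \<le> \<bar>schur_iter R (k - 1) k k\<bar>"
    using assms(3,4) by blast+
qed

lemma pivot_ge_schur_iter:
  "pivot_ge g [Suc t..<Suc m] (schur_iter R t)
    \<longleftrightarrow> (\<exists>k\<in>{Suc t..m}. g \<le> \<bar>schur_iter R (k - 1) k k\<bar>)"
proof (induction "m - t" arbitrary: t)
  case (Suc d)
  then have lt: "t < m" by simp
  have IH: "pivot_ge g [Suc (Suc t)..<Suc m] (schur_iter R (Suc t)) \<longleftrightarrow>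
      (\<exists>k\<in>{Suc (Suc t)..m}. g \<le> \<bar>schur_iter R (k - 1) k k\<bar>)"
    using Suc by (intro Suc.hyps(1)) simp
  have "{Suc t..m} = insert (Suc t) {Suc (Suc t)..m}" using lt by auto
  moreover have "[Suc t..<Suc m] = Suc t # [Suc (Suc t)..<Suc m]"
    using lt by (simp add: upt_conv_Cons)
  ultimately show ?case using IH by (simp del: upt_Suc)
qed auto

lemma strict_piv_schur_iter:
  assumes "\<And>k i j. k \<in> {Suc t..m} \<Longrightarrow> i \<in> {k..m} \<Longrightarrow> j \<in> {k..m} \<Longrightarrow>
      \<bar>schur_iter R (k - 1) i j\<bar> \<le> \<bar>schur_iter R (k - 1) k k\<bar>"
    and "\<And>k. k \<in> {Suc t..m} \<Longrightarrow> c \<le> \<bar>schur_iter R (k - 1) k k\<bar>"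
  shows "strict_piv 1 c [Suc t..<Suc m] (schur_iter R t)"
  using assms
proof (induction "m - t" arbitrary: t)
  case (Suc d)
  then have lt: "t < m" by simp
  have IH: "strict_piv 1 c [Suc (Suc t)..<Suc m] (schur_iter R (Suc t))"
    using Suc.hyps(2) by (intro Suc.hyps(1) Suc.prems) auto
  have "[Suc t..<Suc m] = Suc t # [Suc (Suc t)..<Suc m]"
    using lt by (simp add: upt_conv_Cons)
  moreover have "set (Suc t # [Suc (Suc t)..<Suc m]) = {Suc t..m}" using lt by auto
  ultimately show ?case
    using IH Suc.prems(1)[of "Suc t"] Suc.prems(2)[of "Suc t"] lt by (simp del: upt_Suc)
qed simp

text \<open>The recursion updates all indices, including those already eliminated: a step with
  nonzero pivot clears its own row and column, and a zero row or column stays zero. This makes the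
  factors read off from the iterates triangular.\<close>

lemma ge_iter_eliminated:
  assumes "\<forall>k\<in>{1..m}. ge_iter B (k - 1) k k \<noteq> 0" "t \<le> m"
    and "1 \<le> i \<and> i \<le> t \<or> 1 \<le> j \<and> j \<le> t"
  shows "ge_iter B t i j = 0"
  using assms(2,3)
proof (induction t arbitrary: i j)
  case (Suc t)
  have p: "ge_iter B t (Suc t) (Suc t) \<noteq> 0" using assms(1) Suc.prems(1) by force
  show ?case
  proof (cases "i = Suc t \<or> j = Suc t")
    case True
    then show ?thesis using p by auto
  next
    case False
    then have "ge_iter B t i j = 0" using Suc.prems by (intro Suc.IH) auto
    moreover have "ge_iter B t i (Suc t) = 0 \<or> ge_iter B t (Suc t) j = 0"
      using Suc.prems False Suc.IH[of i "Suc t"] Suc.IH[of "Suc t" j] by auto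
    ultimately show ?thesis by auto
  qed
qed auto

text \<open>Each step subtracts a matrix of rank one; the sum of these is the product of the LU
  factors, column by row.\<close>

lemma ge_iter_telescope:
  "B i j = (\<Sum>k=1..t. ge_iter B (k - 1) i k * (ge_iter B (k - 1) k j / ge_iter B (k - 1) k k))
     + ge_iter B t i j"
  by (induction t) simp_all

text \<open>The extra row and column 0 turn permutations of \<open>{1..n}\<close> into permutations of \<open>{0..<n+1}\<close>
  without any reindexing.\<close>

lemma det_n_eq_det:
  "det_n n B = Determinant.det (Matrix.mat (Suc n) (Suc n)
     (\<lambda>(i, j). if i = 0 \<or> j = 0 then of_bool (i = j) else B i j))"
    (is "_ = Determinant.det ?C")
proof -
  have C: "?C \<in> carrier_mat (Suc n) (Suc n)" by simp
  have "det_n n B = (\<Sum>p | p permutes {1..n}. signof p * (\<Prod>i = 0..<Suc n. ?C $$ (i, p i)))"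
    unfolding det_n_def
  proof (rule sum.cong[OF refl], clarify)
    fix p assume p: "p permutes {1..n}"
    have p0: "p 0 = 0" using p by (simp add: permutes_def)
    have "(\<Prod>i = 0..<Suc n. ?C $$ (i, p i)) = ?C $$ (0, p 0) * (\<Prod>i\<in>{1..n}. ?C $$ (i, p i))"
    proof -
      have "{0..<Suc n} = insert 0 {1..n}" by auto
      then show ?thesis by simp
    qed
    also have "(\<Prod>i\<in>{1..n}. ?C $$ (i, p i)) = (\<Prod>i\<in>{1..n}. B i (p i))"
    proof (rule prod.cong[OF refl])
      fix i assume i: "i \<in> {1..n}"
      then have "p i \<in> {1..n}" using permutes_in_image[OF p] by blast
      then show "?C $$ (i, p i) = B i (p i)" using i by auto
    qed
    finally show "of_int (sign p) * (\<Prod>i\<in>{1..n}. B i (p i)) =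
        signof p * (\<Prod>i = 0..<Suc n. ?C $$ (i, p i))" using p0 by simp
  qed
  also have "\<dots> = (\<Sum>p | p permutes {0..<Suc n}. signof p * (\<Prod>i = 0..<Suc n. ?C $$ (i, p i)))"
  proof (rule sum.mono_neutral_left)
    show "finite {p. p permutes {0..<Suc n}}" by (rule finite_permutations) simp
    show "{p. p permutes {1..n}} \<subseteq> {p. p permutes {0..<Suc n}}"
      by (auto intro: permutes_subset)
    show "\<forall>p\<in>{p. p permutes {0..<Suc n}} - {p. p permutes {1..n}}.
        signof p * (\<Prod>i = 0..<Suc n. ?C $$ (i, p i)) = 0"
    proof
      fix p assume "p \<in> {p. p permutes {0..<Suc n}} - {p. p permutes {1..n}}"
      then have p: "p permutes {0..<Suc n}" and np: "\<not> p permutes {1..n}" by auto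
      have "p 0 \<noteq> 0"
      proof
        assume "p 0 = 0"
        then have "p permutes {0..<Suc n} - {0}"
          using p by (intro permutes_superset[OF p]) auto
        moreover have "{0..<Suc n} - {0} = {1..n}" by auto
        ultimately show False using np by simp
      qed
      moreover have "p 0 < Suc n" using permutes_in_image[OF p, of 0] by simp
      ultimately have "?C $$ (0, p 0) = 0" by simp
      then have "(\<Prod>i = 0..<Suc n. ?C $$ (i, p i)) = 0"
        by (intro prod_zero bexI[of _ 0]) auto
      then show "signof p * (\<Prod>i = 0..<Suc n. ?C $$ (i, p i)) = 0" by simp
    qed
  qed
  also have "\<dots> = Determinant.det ?C" using det_def'[OF C] by simp
  finally show ?thesis .
qed

text \<open>Membership in \<open>CP\<close> asks for a nonzero determinant. Here
  \<open>B = L * U\<close> up to the border at index 0, with the pivots on the diagonal of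
  \<open>L\<close> and ones on that of \<open>U\<close>. The last pivot must be nonzero too, which
  \<open>ge_defined\<close> does not say.\<close>

lemma invertible_n_if_pivots:
  assumes nz: "\<forall>k\<in>{1..m}. ge_iter B (k - 1) k k \<noteq> 0"
  shows "invertible_n m B"
proof -
  define L where "L = Matrix.mat (Suc m) (Suc m)
    (\<lambda>(i, k). if i = 0 \<or> k = 0 then of_bool (i = k) else ge_iter B (k - 1) i k)"
  define U where "U = Matrix.mat (Suc m) (Suc m)
    (\<lambda>(k, j). if k = 0 \<or> j = 0 then of_bool (k = j)
       else ge_iter B (k - 1) k j / ge_iter B (k - 1) k k)"
  define C where "C = Matrix.mat (Suc m) (Suc m)
     (\<lambda>(i, j). if i = 0 \<or> j = 0 then of_bool (i = j) else B i j)"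
  have LC: "L \<in> carrier_mat (Suc m) (Suc m)" and UC: "U \<in> carrier_mat (Suc m) (Suc m)"
    by (simp_all add: L_def U_def)
  have L0: "L $$ (i, j) = 0" if "i < j" "j < Suc m" for i j
  proof -
    have "ge_iter B (j - 1) i j = 0" if "i \<noteq> 0"
      using that \<open>i < j\<close> \<open>j < Suc m\<close> by (intro ge_iter_eliminated[OF nz]) auto
    then show ?thesis using that by (auto simp: L_def)
  qed
  have U0: "U $$ (i, j) = 0" if "j < i" "i < Suc m" for i j
  proof -
    have "ge_iter B (i - 1) i j = 0" if "j \<noteq> 0"
      using that \<open>j < i\<close> \<open>i < Suc m\<close> by (intro ge_iter_eliminated[OF nz]) auto
    then show ?thesis using that by (auto simp: U_def)
  qed
  have "C = L * U"
  proof (rule eq_matI)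
    fix i j assume "i < dim_row (L * U)" "j < dim_col (L * U)"
    then have ij: "i < Suc m" "j < Suc m" by (auto simp: L_def U_def)
    have split: "{0..<Suc m} = insert 0 {1..m}" by auto
    have "(L * U) $$ (i, j) = (\<Sum>k = 0..<Suc m. L $$ (i, k) * U $$ (k, j))"
      using ij LC UC by (simp add: scalar_prod_def del: sum.op_ivl_Suc)
    also have "\<dots> = L $$ (i, 0) * U $$ (0, j) + (\<Sum>k=1..m. L $$ (i, k) * U $$ (k, j))"
      unfolding split by simp
    also have "\<dots> = C $$ (i, j)"
    proof (cases "i = 0 \<or> j = 0")
      case True
      then have "L $$ (i, k) * U $$ (k, j) = 0" if "k \<in> {1..m}" for k
        using that ij by (auto simp: L_def U_def)
      then show ?thesis using True ij by (auto simp: L_def U_def C_def)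
    next
      case False
      have "ge_iter B m i j = 0" using False ij by (intro ge_iter_eliminated[OF nz]) auto
      then have "B i j = (\<Sum>k=1..m. ge_iter B (k - 1) i k *
          (ge_iter B (k - 1) k j / ge_iter B (k - 1) k k))"
        using ge_iter_telescope[of B i j m] by simp
      also have "\<dots> = (\<Sum>k=1..m. L $$ (i, k) * U $$ (k, j))"
        using False ij by (intro sum.cong) (auto simp: L_def U_def)
      finally show ?thesis using False ij by (simp add: L_def U_def C_def)
    qed
    finally show "C $$ (i, j) = (L * U) $$ (i, j)" by simp
  qed (simp_all add: C_def L_def U_def)
  moreover have "Determinant.det L \<noteq> 0"
  proof -
    have "Determinant.det L = prod_list (diag_mat L)"
      by (rule det_lower_triangular[OF L0 LC])
    also have "\<dots> = (\<Prod>i = 0..<Suc m. L $$ (i, i))"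
      using LC by (simp add: prod_list_diag_prod)
    also have "\<dots> \<noteq> 0" using nz by (auto simp: L_def)
    finally show ?thesis .
  qed
  moreover have "Determinant.det U \<noteq> 0"
  proof -
    have "upper_triangular U" using U0 UC by (intro upper_triangularI) auto
    then have "Determinant.det U = prod_list (diag_mat U)"
      using UC by (rule det_upper_triangular)
    also have "\<dots> = (\<Prod>i = 0..<Suc m. U $$ (i, i))"
      using UC by (simp add: prod_list_diag_prod)
    also have "\<dots> \<noteq> 0" using nz by (auto simp: U_def)
    finally show ?thesis .
  qed
  ultimately have "Determinant.det C \<noteq> 0" using det_mult[OF LC UC] by simp
  then show ?thesis by (simp add: invertible_n_def det_n_eq_det C_def)
qed


section \<open>The 0/1 gadget that subtracts binary digits\<close>

datatype label = Base nat | Gadget nat nat nat | Pad nat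

text \<open>\<open>gstate x u \<kappa>\<close> is the matrix reached when, for every column \<open>j\<close>, the first \<open>\<kappa> j\<close> bits have been
  eliminated; only the labels not yet eliminated are meaningful. Bit \<open>k\<close> of column \<open>j\<close> is the
  circulant block with rows (1,1,0), (0,1,1), (1,0,1) on the labels \<open>Gadget j k r\<close>, \<open>r = 0, 1, 2\<close>.
  Its pivots are 1, 1, 2, and the pivot 2 halves the value passed on to the next bit, so that bit
  \<open>k\<close> subtracts \<open>u i j k / 2 ^ (k + 1)\<close> from entry \<open>(i, j)\<close>. \<open>Pad\<close> labels carry an identity block that only
  enlarges the matrix.\<close>

definition linked :: "nat \<Rightarrow> nat \<Rightarrow> nat \<Rightarrow> nat \<Rightarrow> bool" where
  "linked k r k' r' \<longleftrightarrow> k = k' \<and> (r, r') \<in> {(0,0), (0,1), (1,1), (1,2), (2,0), (2,2)}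
     \<or> k = Suc k' \<and> r = 0 \<and> r' = 2"

context
  fixes x :: "nat \<Rightarrow> nat \<Rightarrow> real" and u :: "nat \<Rightarrow> nat \<Rightarrow> nat \<Rightarrow> real"
begin

fun gstate :: "(nat \<Rightarrow> nat) \<Rightarrow> label \<Rightarrow> label \<Rightarrow> real" where
  "gstate \<kappa> (Base i) (Base j) = x i j - (\<Sum>k<\<kappa> j. u i j k / 2 ^ Suc k)"
| "gstate \<kappa> (Base i) (Gadget j k r) = (if r = 2 then u i j k else 0)"
| "gstate \<kappa> (Gadget j k r) (Base j') =
     (if j \<noteq> j' then 0 else if k = 0 \<and> r = 2 then 1
      else if k = \<kappa> j \<and> k \<noteq> 0 \<and> r = 0 then - 1 / 2 ^ k else 0)"
| "gstate \<kappa> (Gadget j k r) (Gadget j' k' r') =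
     of_bool (j = j' \<and> linked k r k' r')"
| "gstate \<kappa> (Pad p) b = of_bool (b = Pad p)"
| "gstate \<kappa> a (Pad p) = 0"

end

text \<open>The remaining rows vanish in columns \<open>a\<close> and \<open>b\<close>, so the first
  two pivots change, apart from row \<open>c\<close>, nothing that survives. Row \<open>c\<close>
  becomes row \<open>c\<close> minus row \<open>a\<close> plus row \<open>b\<close>, with entry 2 at
  \<open>c\<close>; row \<open>b\<close> vanishes on \<open>zs\<close>, and the third step divides
  by 2. The bound on \<open>M c j - M a j\<close> keeps row \<open>c\<close> below the
  pivots.\<close>

lemma comp_piv_block:
  fixes M :: "'a \<Rightarrow> 'a \<Rightarrow> real"
  assumes block: "M a a = 1" "M a b = 1" "M a c = 0" "M b a = 0" "M b b = 1" "M b c = 1"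
      "M c a = 1" "M c b = 0" "M c c = 1"
    and cols: "\<And>i. i \<in> set zs \<Longrightarrow> M i a = 0 \<and> M i b = 0"
    and rows: "\<And>j. j \<in> set zs \<Longrightarrow> M b j = 0 \<and> \<bar>M c j - M a j\<bar> \<le> 1"
    and bound: "\<And>i j. i \<in> set (a # b # c # zs) \<Longrightarrow> j \<in> set (a # b # c # zs) \<Longrightarrow> \<bar>M i j\<bar> \<le> 1"
    and step: "\<And>i j. i \<in> set zs \<Longrightarrow> j \<in> set zs \<Longrightarrow>
      M' i j = M i j - M i c * (M c j - M a j) / 2"
  shows "comp_piv zs M' \<Longrightarrow> comp_piv (a # b # c # zs) M"
    and "pivot_ge g zs M' \<Longrightarrow> pivot_ge g (a # b # c # zs) M"
proof -
  define M1 where "M1 = schur a M"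
  define M2 where "M2 = schur b M1"
  have M1: "M1 i j = M i j" if "i \<in> set (b # zs)" for i j
    using that cols block by (auto simp: M1_def schur_def)
  have M1c: "M1 c j = M c j - M a j" for j
    using block by (simp add: M1_def schur_def)
  have M2z: "M2 i j = M i j" if "i \<in> set zs" for i j
    using that cols[of i] M1[of i] by (simp add: M2_def schur_def)
  have M2c: "M2 c j = M1 c j + M b j" for j
    using M1[of b] M1c[of b] block by (simp add: M2_def schur_def)
  have M3: "schur c M2 i j = M' i j" if "i \<in> set zs" "j \<in> set zs" for i j
    using that M2z[of i] M2c M1c block rows[of j] step[of i j] by (simp add: schur_def)
  have b1: "\<bar>M1 i j\<bar> \<le> \<bar>M1 b b\<bar>" if "i \<in> set (b # c # zs)" "j \<in> set (b # c # zs)" for i j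
  proof (cases "i = c")
    case True
    then show ?thesis using that block rows[of j] M1[of b b] M1c[of j] by auto
  next
    case False
    then have "i \<in> set (b # zs)" using that by auto
    then show ?thesis using M1[of i j] M1[of b b] block bound[of i j] that by auto
  qed
  have b2: "\<bar>M2 i j\<bar> \<le> \<bar>M2 c c\<bar>" if "i \<in> set (c # zs)" "j \<in> set (c # zs)" for i j
  proof (cases "i = c")
    case True
    then show ?thesis using that block rows[of j] M2c M1c by auto
  next
    case False
    then have "i \<in> set zs" using that by auto
    then show ?thesis using M2z[of i j] M2c[of c] M1c[of c] block bound[of i j] that by auto
  qed
  have e: "schur b M1 = M2" "schur a M = M1" by (simp_all add: M1_def M2_def)
  have c0: "comp_piv (a # b # c # zs) M \<longleftrightarrow> comp_piv zs (schur c M2)"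
    using bound b1 b2 block M1[of b b] M2c[of c] M1c[of c] by (simp add: e)
  show "comp_piv (a # b # c # zs) M" if "comp_piv zs M'"
    using that M3 comp_piv_cong[of zs "schur c M2" M'] c0 by simp
  show "pivot_ge g (a # b # c # zs) M" if "pivot_ge g zs M'"
    using that M3 pivot_ge_cong[of zs "schur c M2" M' g] by (simp add: e)
qed

lemma binary_sum_bounds:
  fixes v :: "nat \<Rightarrow> real"
  assumes "\<And>k. v k \<in> {0, 1}"
  shows "0 \<le> (\<Sum>k<K. v k / 2 ^ Suc k) \<and> (\<Sum>k<K. v k / 2 ^ Suc k) \<le> 1 - 1 / 2 ^ K"
proof (induction K)
  case (Suc K)
  define h :: real where "h = 1 / 2 ^ Suc K"
  have "0 < h" "1 / 2 ^ K = 2 * h" by (simp_all add: h_def)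
  moreover have "v K / 2 ^ Suc K = 0 \<or> v K / 2 ^ Suc K = h"
    using assms[of K] by (auto simp: h_def)
  ultimately show ?case using Suc unfolding sum.lessThan_Suc h_def[symmetric] by linarith
qed simp

text \<open>Greedy digits: the next digit is 1 exactly when the remainder is at least half of its
  bound. The closed bound covers \<open>t = 1\<close>, whose digits are all 1.\<close>

lemma binary_expansion:
  fixes t :: real
  assumes "0 \<le> t" "t \<le> 1"
  shows "\<exists>v. (\<forall>k. v k \<in> {0, 1}) \<and> \<bar>t - (\<Sum>k<K. v k / 2 ^ Suc k)\<bar> \<le> 1 / 2 ^ K"
proof -
  have "\<exists>v. (\<forall>k. v k \<in> {0, 1}) \<and> 0 \<le> t - (\<Sum>k<K. v k / 2 ^ Suc k)
      \<and> t - (\<Sum>k<K. v k / 2 ^ Suc k) \<le> 1 / 2 ^ K"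
  proof (induction K)
    case 0
    show ?case using assms by (intro exI[of _ "\<lambda>_. 0"]) simp
  next
    case (Suc K)
    then obtain v where v: "\<forall>k. v k \<in> {0, 1}" "0 \<le> t - (\<Sum>k<K. v k / 2 ^ Suc k)"
      "t - (\<Sum>k<K. v k / 2 ^ Suc k) \<le> 1 / 2 ^ K" by blast
    define r where "r = t - (\<Sum>k<K. v k / 2 ^ Suc k)"
    define w where "w = v(K := of_bool (1 / 2 ^ Suc K \<le> r))"
    have "(\<Sum>k<K. w k / 2 ^ Suc k) = (\<Sum>k<K. v k / 2 ^ Suc k)"
      by (intro sum.cong) (auto simp: w_def)
    then have "t - (\<Sum>k<Suc K. w k / 2 ^ Suc k) = r - of_bool (1 / 2 ^ Suc K \<le> r) / 2 ^ Suc K"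
      by (simp add: r_def w_def)
    moreover have "1 / 2 ^ K = 2 * (1 / 2 ^ Suc K :: real)" by simp
    ultimately have "0 \<le> t - (\<Sum>k<Suc K. w k / 2 ^ Suc k)
        \<and> t - (\<Sum>k<Suc K. w k / 2 ^ Suc k) \<le> 1 / 2 ^ Suc K"
      using v(2,3) unfolding r_def[symmetric] by (simp del: power_Suc)
    moreover have "\<forall>k. w k \<in> {0, 1}" using v(1) by (simp add: w_def)
    ultimately show ?case by blast
  qed
  then show ?thesis by (metis abs_of_nonneg)
qed

text \<open>The gadgets can only subtract, so a nonnegative target is reached from 1 and a negative
  one from 0; in both cases the amount to subtract lies in [0,1].\<close>

lemma signed_binary_expansion:
  fixes t :: real
  assumes "\<bar>t\<bar> \<le> 1"
  shows "\<exists>y v. y \<in> {0, 1} \<and> (\<forall>k. v k \<in> {0, 1})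
    \<and> \<bar>y - (\<Sum>k<K. v k / 2 ^ Suc k) - t\<bar> \<le> 1 / 2 ^ K"
proof -
  define y :: real where "y = of_bool (0 \<le> t)"
  have "0 \<le> y - t" "y - t \<le> 1" using assms by (auto simp: y_def)
  then obtain v where v: "\<forall>k. v k \<in> {0, 1}"
      "\<bar>(y - t) - (\<Sum>k<K. v k / 2 ^ Suc k)\<bar> \<le> 1 / 2 ^ K"
    using binary_expansion by blast
  have "y - (\<Sum>k<K. v k / 2 ^ Suc k) - t = (y - t) - (\<Sum>k<K. v k / 2 ^ Suc k)" by simp
  with v show ?thesis by (intro exI[of _ y] exI[of _ v]) (simp add: y_def)
qed

fun active :: "(nat \<Rightarrow> nat) \<Rightarrow> label \<Rightarrow> bool" where
  "active \<kappa> (Gadget j k r) \<longleftrightarrow> \<kappa> j \<le> k"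
| "active \<kappa> _ \<longleftrightarrow> True"

context
  fixes x :: "nat \<Rightarrow> nat \<Rightarrow> real" and u :: "nat \<Rightarrow> nat \<Rightarrow> nat \<Rightarrow> real"
  assumes x01: "\<And>i j. x i j \<in> {0, 1}" and u01: "\<And>i j k. u i j k \<in> {0, 1}"
begin

text \<open>Being valid in every state, this bound makes any entry 1 an admissible pivot at any
  time.\<close>

lemma gstate_bound: "\<bar>gstate x u \<kappa> a b\<bar> \<le> 1"
proof -
  have "\<bar>x i j - (\<Sum>k<\<kappa> j. u i j k / 2 ^ Suc k)\<bar> \<le> 1" for i j
  proof -
    have "(0::real) < 1 / 2 ^ \<kappa> j" by simp
    moreover have "x i j = 0 \<or> x i j = 1" using x01[of i j] by auto
    ultimately show ?thesis
      using binary_sum_bounds[of "u i j" "\<kappa> j", OF u01] by linarith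
  qed
  moreover have "\<bar>u i j k\<bar> \<le> 1" for i j k using u01[of i j k] by auto
  ultimately show ?thesis
    by (cases a; cases b) auto
qed

text \<open>In the initial state the digit sums are empty, and the negative entries, which need
  \<open>k = \<kappa> j\<close> and \<open>k \<noteq> 0\<close>, do not occur.\<close>

lemma gstate_binary: "gstate x u (\<lambda>_. 0) a b \<in> {0, 1}"
proof -
  have "x i j = 0 \<or> x i j = 1" "u i j k = 0 \<or> u i j k = 1" for i j k
    using x01[of i j] u01[of i j k] by auto
  then show ?thesis by (cases a; cases b) auto
qed

lemma linked_less: "k < k' \<Longrightarrow> \<not> linked k r k' r'" "k' < k \<Longrightarrow> linked k r k' r' \<longleftrightarrow> k = Suc k' \<and> r = 0 \<and> r' = 2"
  by (auto simp: linked_def)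

text \<open>In column \<open>Base j\<close>, row 2 minus row 0 of the gadget is
  \<open>1 / 2 ^ \<kappa> j\<close>: for the first digit from the 1 in row 2, later from the
  negative entry in row 0. The pivot 2 halves it. Multiplied by the digits in column 2 it is
  subtracted from the rows \<open>Base i\<close>; through the link between consecutive gadgets it
  leaves \<open>- 1 / 2 ^ Suc (\<kappa> j)\<close> in row 0 of the next one.\<close>

lemma gstate_block:
  assumes act: "\<And>z. z \<in> set zs \<Longrightarrow> active (\<kappa>(j := Suc (\<kappa> j))) z"
  defines "ys \<equiv> [Gadget j (\<kappa> j) 0, Gadget j (\<kappa> j) 1, Gadget j (\<kappa> j) 2]"
  shows "comp_piv zs (gstate x u (\<kappa>(j := Suc (\<kappa> j)))) \<Longrightarrow> comp_piv (ys @ zs) (gstate x u \<kappa>)"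
    and "pivot_ge g zs (gstate x u (\<kappa>(j := Suc (\<kappa> j)))) \<Longrightarrow> pivot_ge g (ys @ zs) (gstate x u \<kappa>)"
proof -
  let ?M = "gstate x u \<kappa>" and ?M' = "gstate x u (\<kappa>(j := Suc (\<kappa> j)))"
  let ?a = "Gadget j (\<kappa> j) 0" and ?b = "Gadget j (\<kappa> j) 1" and ?c = "Gadget j (\<kappa> j) 2"
  have cols: "?M i ?a = 0 \<and> ?M i ?b = 0" if "i \<in> set zs" for i
    using act[OF that] by (cases i) (auto simp: linked_less split: if_splits)
  have rows: "?M ?b i = 0 \<and> \<bar>?M ?c i - ?M ?a i\<bar> \<le> 1" if "i \<in> set zs" for i
    using act[OF that] by (cases i) (auto simp: linked_less split: if_splits)
  have nxt: "?M' i l = ?M i l - ?M i ?c * (?M ?c l - ?M ?a l) / 2"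
    if "i \<in> set zs" "l \<in> set zs" for i l
  proof (cases "l = Base j")
    case True
    have "?M ?c l - ?M ?a l = 1 / 2 ^ \<kappa> j" using True by simp
    moreover have "?M' i l = ?M i l - ?M i ?c * (1 / 2 ^ Suc (\<kappa> j))"
      using act[OF that(1)] True by (cases i) (auto simp: linked_less Suc_le_eq split: if_splits)
    ultimately show ?thesis by simp
  next
    case False
    have "?M ?c l - ?M ?a l = 0" using act[OF that(2)] False
      by (cases l) (auto simp: linked_less split: if_splits)
    moreover have "?M' i l = ?M i l" using act[OF that(1)] act[OF that(2)] False
      by (cases i; cases l) (auto split: if_splits)
    ultimately show ?thesis by simp
  qed
  have Q: "?M ?a ?a = 1" "?M ?a ?b = 1" "?M ?a ?c = 0" "?M ?b ?a = 0" "?M ?b ?b = 1"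
    "?M ?b ?c = 1" "?M ?c ?a = 1" "?M ?c ?b = 0" "?M ?c ?c = 1"
    by (simp_all add: linked_def)
  note block = comp_piv_block[where M = ?M and M' = ?M' and zs = zs, OF Q cols rows gstate_bound nxt]
  show "comp_piv (ys @ zs) ?M" if "comp_piv zs ?M'"
    unfolding ys_def append_Cons append_Nil by (rule block(1)) (use that in auto)
  show "pivot_ge g (ys @ zs) ?M" if "pivot_ge g zs ?M'"
    unfolding ys_def append_Cons append_Nil by (rule block(2)) (use that in auto)
qed

text \<open>Induction on the number of digits left. A gadget changes only its own column of base
  entries, and \<open>\<kappa>\<close> records the state whatever the order, so any column with
  digits left may come next.\<close>

lemma gstate_gadgets:
  assumes "finite J" "\<forall>j. \<kappa> j \<le> K j" "\<forall>j. j \<notin> J \<longrightarrow> \<kappa> j = K j"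
    and base: "comp_piv (map Base bs) (gstate x u K)"
      "pivot_ge g (map Base bs) (gstate x u K)"
  shows "\<exists>zs. length zs = 3 * (\<Sum>j\<in>J. K j - \<kappa> j) + length bs
    \<and> (\<forall>z\<in>set zs. active \<kappa> z \<and> (\<forall>p. z \<noteq> Pad p))
    \<and> comp_piv zs (gstate x u \<kappa>) \<and> pivot_ge g zs (gstate x u \<kappa>)"
  using assms(2,3)
proof (induction "\<Sum>j\<in>J. K j - \<kappa> j" arbitrary: \<kappa>)
  case 0
  then have "\<kappa> j = K j" for j
    using \<open>finite J\<close> by (cases "j \<in> J") (auto intro!: le_antisym)
  then have "\<kappa> = K" by (rule ext)
  show ?case unfolding \<open>\<kappa> = K\<close> using base
    by (intro exI[of _ "map Base bs"]) auto
next
  case (Suc d)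
  have "\<exists>j\<in>J. \<kappa> j < K j"
  proof (rule ccontr)
    assume "\<not> ?thesis"
    then have "(\<Sum>j\<in>J. K j - \<kappa> j) = 0" by (intro sum.neutral) auto
    then show False using Suc.hyps(2) by simp
  qed
  then obtain j where j: "j \<in> J" "\<kappa> j < K j" by blast
  define \<kappa>' where "\<kappa>' = \<kappa>(j := Suc (\<kappa> j))"
  have "(\<Sum>i\<in>J. K i - \<kappa> i) = (K j - \<kappa> j) + (\<Sum>i\<in>J - {j}. K i - \<kappa> i)"
    using j \<open>finite J\<close> by (simp add: sum.remove)
  moreover have "(\<Sum>i\<in>J. K i - \<kappa>' i) = (K j - Suc (\<kappa> j)) + (\<Sum>i\<in>J - {j}. K i - \<kappa>' i)"
    using j \<open>finite J\<close> by (simp add: sum.remove \<kappa>'_def)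
  moreover have "(\<Sum>i\<in>J - {j}. K i - \<kappa>' i) = (\<Sum>i\<in>J - {j}. K i - \<kappa> i)"
    by (intro sum.cong) (auto simp: \<kappa>'_def)
  ultimately have sum: "(\<Sum>i\<in>J. K i - \<kappa> i) = Suc (\<Sum>i\<in>J. K i - \<kappa>' i)" using j by simp
  have "\<exists>zs. length zs = 3 * (\<Sum>j\<in>J. K j - \<kappa>' j) + length bs
      \<and> (\<forall>z\<in>set zs. active \<kappa>' z \<and> (\<forall>p. z \<noteq> Pad p))
      \<and> comp_piv zs (gstate x u \<kappa>') \<and> pivot_ge g zs (gstate x u \<kappa>')"
  proof (rule Suc.hyps(1))
    show "d = (\<Sum>j\<in>J. K j - \<kappa>' j)" using sum Suc.hyps(2) by simp
  qed (use j Suc.prems in \<open>auto simp: \<kappa>'_def\<close>)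
  then obtain zs where zs: "length zs = 3 * (\<Sum>j\<in>J. K j - \<kappa>' j) + length bs"
      "\<forall>z\<in>set zs. active \<kappa>' z \<and> (\<forall>p. z \<noteq> Pad p)"
      "comp_piv zs (gstate x u \<kappa>')" "pivot_ge g zs (gstate x u \<kappa>')"
    by blast
  let ?ys = "[Gadget j (\<kappa> j) 0, Gadget j (\<kappa> j) 1, Gadget j (\<kappa> j) 2]"
  have "active \<kappa> z" if "active \<kappa>' z" for z
    using that by (cases z) (auto simp: \<kappa>'_def split: if_splits)
  then have "\<forall>z\<in>set (?ys @ zs). active \<kappa> z \<and> (\<forall>p. z \<noteq> Pad p)" using zs(2) by auto
  moreover have "length (?ys @ zs) = 3 * (\<Sum>j\<in>J. K j - \<kappa> j) + length bs"
    using zs(1) sum by simp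
  moreover have "comp_piv (?ys @ zs) (gstate x u \<kappa>)" "pivot_ge g (?ys @ zs) (gstate x u \<kappa>)"
    using zs gstate_block[of zs \<kappa> j] unfolding \<kappa>'_def by blast+
  ultimately show ?case by blast
qed

text \<open>A pad is a pivot 1 alone in its row and column. It may be eliminated first because no
  entry exceeds 1, and it leaves the other entries unchanged.\<close>

lemma gstate_pads:
  assumes "comp_piv zs (gstate x u \<kappa>)" "pivot_ge g zs (gstate x u \<kappa>)"
    and "\<forall>z\<in>set zs. \<forall>p. z \<noteq> Pad p"
  shows "\<exists>ys. length ys = l + length zs \<and> (\<forall>p\<ge>l. Pad p \<notin> set ys)
    \<and> comp_piv ys (gstate x u \<kappa>) \<and> pivot_ge g ys (gstate x u \<kappa>)"
proof (induction l)
  case 0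
  then show ?case using assms by auto
next
  case (Suc l)
  then obtain ys where ys: "length ys = l + length zs" "\<forall>p\<ge>l. Pad p \<notin> set ys"
      "comp_piv ys (gstate x u \<kappa>)" "pivot_ge g ys (gstate x u \<kappa>)" by blast
  have "schur (Pad l) (gstate x u \<kappa>) i j = gstate x u \<kappa> i j" if "i \<in> set ys" "j \<in> set ys" for i j
  proof -
    have "j \<noteq> Pad l" using that ys(2) by auto
    then show ?thesis by (simp add: schur_def)
  qed
  then have "comp_piv ys (schur (Pad l) (gstate x u \<kappa>))" "pivot_ge g ys (schur (Pad l) (gstate x u \<kappa>))"
    using ys(3,4) comp_piv_cong[of ys "schur (Pad l) (gstate x u \<kappa>)" "gstate x u \<kappa>"]
      pivot_ge_cong[of ys "schur (Pad l) (gstate x u \<kappa>)" "gstate x u \<kappa>" g] by auto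
  then have "comp_piv (Pad l # ys) (gstate x u \<kappa>)" "pivot_ge g (Pad l # ys) (gstate x u \<kappa>)"
    using gstate_bound by simp_all
  then show ?case using ys(1,2)
    by (intro exI[of _ "Pad l # ys"]) auto
qed

end


section \<open>From strictly pivoted matrices to matrices with two values\<close>

lemma exists_binary_matrix:
  fixes T :: "nat \<Rightarrow> nat \<Rightarrow> real"
  assumes strict: "strict_piv \<sigma> \<delta> bs T" and piv: "pivot_ge g bs T" and "distinct bs"
    and le1: "\<And>i j. i \<in> set bs \<Longrightarrow> j \<in> set bs \<Longrightarrow> \<bar>T i j\<bar> \<le> 1"
    and "0 < \<sigma>" "\<sigma> \<le> 1" "0 < \<delta>"
    and prec: "4 ^ length bs / 2 ^ K \<le> 2 * (1 - \<sigma>) * \<delta>"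
    and N: "3 * K * length bs + length bs \<le> N"
  shows "\<exists>W. (\<forall>i j. W i j \<in> {0, 1}) \<and> comp_piv [1..<Suc N] W
    \<and> pivot_ge (g - 4 ^ length bs / 2 ^ K) [1..<Suc N] W"
proof -
  let ?g = "g - 4 ^ length bs / 2 ^ K"
  define P where "P i j yv \<longleftrightarrow> fst yv \<in> {0, 1 :: real} \<and> (\<forall>k. snd yv k \<in> {0, 1 :: real}) \<and>
      (i \<in> set bs \<and> j \<in> set bs \<longrightarrow>
        \<bar>fst yv - (\<Sum>k<K. snd yv k / 2 ^ Suc k) - T i j\<bar> \<le> 1 / 2 ^ K)" for i j yv
  define f where "f i j = (SOME yv. P i j yv)" for i j
  have "\<exists>yv. P i j yv" for i j
  proof (cases "i \<in> set bs \<and> j \<in> set bs")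
    case True
    then obtain y v where "y \<in> {0, 1}" "\<forall>k. v k \<in> {0, 1}"
        "\<bar>y - (\<Sum>k<K. v k / 2 ^ Suc k) - T i j\<bar> \<le> 1 / 2 ^ K"
      using signed_binary_expansion[OF le1[of i j], of K] by blast
    then show ?thesis by (intro exI[of _ "(y, v)"]) (simp add: P_def)
  next
    case False
    then show ?thesis by (intro exI[of _ "(0, \<lambda>_. 0)"]) (auto simp: P_def)
  qed
  then have f: "P i j (f i j)" for i j unfolding f_def by (rule someI_ex)
  define x where "x i j = fst (f i j)" for i j
  define u where "u i j = snd (f i j)" for i j
  have x01: "x i j \<in> {0, 1}" and u01: "u i j k \<in> {0, 1}" for i j k
    using f[of i j] by (simp_all add: P_def x_def u_def)
  have approx: "\<bar>x i j - (\<Sum>k<K. u i j k / 2 ^ Suc k) - T i j\<bar> \<le> 1 / 2 ^ K"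
    if "i \<in> set bs" "j \<in> set bs" for i j
    using f[of i j] that by (simp add: P_def x_def u_def)
  \<comment> \<open>This is the final state. Columns outside \<open>bs\<close> have no digits, so
    there it agrees with the initial state, as \<open>gstate_gadgets\<close> requires.\<close>
  define \<kappa> where "\<kappa> = (\<lambda>j. if j \<in> set bs then K else 0)"
  let ?T' = "\<lambda>i j. gstate x u \<kappa> (Base i) (Base j)"
  have "\<forall>i\<in>set bs. \<forall>j\<in>set bs. \<bar>?T' i j - T i j\<bar> \<le> 1 / 2 ^ K"
    using approx by (simp add: \<kappa>_def)
  then have "comp_piv bs ?T' \<and> (pivot_ge g bs T \<longrightarrow> pivot_ge (g - 4 ^ length bs * (1 / 2 ^ K)) bs ?T')"
    using assms by (intro strict_piv_perturb[OF strict]) auto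
  then have base: "comp_piv (map Base bs) (gstate x u \<kappa>)" "pivot_ge ?g (map Base bs) (gstate x u \<kappa>)"
    using piv by (simp_all add: comp_piv_map pivot_ge_map)
  have sum: "(\<Sum>j\<in>set bs. \<kappa> j - 0) = K * length bs"
    using \<open>distinct bs\<close> by (simp add: \<kappa>_def distinct_card)
  have "\<exists>zs. length zs = 3 * (\<Sum>j\<in>set bs. \<kappa> j - 0) + length bs
      \<and> (\<forall>z\<in>set zs. active (\<lambda>_. 0) z \<and> (\<forall>p. z \<noteq> Pad p))
      \<and> comp_piv zs (gstate x u (\<lambda>_. 0)) \<and> pivot_ge ?g zs (gstate x u (\<lambda>_. 0))"
    by (rule gstate_gadgets[OF x01 u01 _ _ _ base]) (auto simp: \<kappa>_def)
  then obtain zs where zs: "length zs = 3 * K * length bs + length bs"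
      "\<forall>z\<in>set zs. \<forall>p. z \<noteq> Pad p"
      "comp_piv zs (gstate x u (\<lambda>_. 0))" "pivot_ge ?g zs (gstate x u (\<lambda>_. 0))"
    unfolding sum by (auto simp: mult.assoc)
  obtain ys where ys: "length ys = (N - length zs) + length zs"
      "comp_piv ys (gstate x u (\<lambda>_. 0))" "pivot_ge ?g ys (gstate x u (\<lambda>_. 0))"
    using gstate_pads[OF x01 u01 zs(3,4,2), of "N - length zs"] by blast
  have "length ys = N" using ys(1) zs(1) N by simp
  \<comment> \<open>List positions start at 0, matrix indices at 1.\<close>
  then have ys_eq: "ys = map (\<lambda>i. ys ! (i - 1)) [1..<Suc N]"
    by (intro nth_equalityI) (simp_all del: upt_Suc)
  define W where "W = (\<lambda>i j. gstate x u (\<lambda>_. 0) (ys ! (i - 1)) (ys ! (j - 1)))"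
  have "comp_piv [1..<Suc N] W" "pivot_ge ?g [1..<Suc N] W"
    using ys(2,3) ys_eq unfolding W_def
    by (metis comp_piv_map, metis pivot_ge_map)
  moreover have "\<forall>i j. W i j \<in> {0, 1}" using gstate_binary[OF x01 u01] by (simp add: W_def)
  ultimately show ?thesis by blast
qed

text \<open>The constant first row and column turn the entries \<open>b\<close>, \<open>a\<close> into \<open>0\<close>, \<open>a - b\<close> after one step.\<close>

lemma comp_piv_border:
  fixes a b :: real
  assumes W: "\<And>i j. W i j \<in> {0, 1}" "comp_piv [1..<Suc N] W" "pivot_ge g [1..<Suc N] W"
    and "a \<noteq> b" "\<bar>a\<bar> \<le> \<bar>b\<bar>"
  defines "B \<equiv> \<lambda>i j. if i = 1 \<or> j = 1 then b else b + (a - b) * W (i - 1) (j - 1)"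
  shows "comp_piv [1..<Suc (Suc N)] B" "pivot_ge (\<bar>a - b\<bar> * g) [1..<Suc (Suc N)] B"
    and "B i j \<in> {a, b}"
proof -
  have B: "B i j \<in> {a, b}" for i j using W(1)[of "i - 1" "j - 1"] by (auto simp: B_def)
  then show "B i j \<in> {a, b}" .
  have list: "[1..<Suc (Suc N)] = 1 # map Suc [1..<Suc N]"
    by (simp add: upt_conv_Cons map_Suc_upt del: upt_Suc)
  have "b \<noteq> 0" using assms by auto
  have B11: "B 1 1 = b" by (simp add: B_def)
  have bound: "\<bar>B i j\<bar> \<le> \<bar>B 1 1\<bar>" for i j using B[of i j] B11 \<open>\<bar>a\<bar> \<le> \<bar>b\<bar>\<close> by auto
  have sch: "\<forall>i\<in>set [1..<Suc N]. \<forall>j\<in>set [1..<Suc N].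
      schur 1 B (Suc i) (Suc j) = (a - b) * W i j"
    using \<open>b \<noteq> 0\<close> by (auto simp: schur_def B_def)
  have ab: "a - b \<noteq> 0" using \<open>a \<noteq> b\<close> by simp
  have "comp_piv [1..<Suc N] (\<lambda>i j. schur 1 B (Suc i) (Suc j))"
    using comp_piv_scale[OF ab W(2)] comp_piv_cong[OF sch] by simp
  then have "comp_piv (map Suc [1..<Suc N]) (schur 1 B)" by (simp only: comp_piv_map)
  then show "comp_piv [1..<Suc (Suc N)] B"
    unfolding list using bound B11 \<open>b \<noteq> 0\<close> by simp
  have "pivot_ge (\<bar>a - b\<bar> * g) [1..<Suc N] (\<lambda>i j. schur 1 B (Suc i) (Suc j))"
    using pivot_ge_scale[OF ab W(3)] pivot_ge_cong[OF sch] by simp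
  then have "pivot_ge (\<bar>a - b\<bar> * g) (map Suc [1..<Suc N]) (schur 1 B)" by (simp only: pivot_ge_map)
  then show "pivot_ge (\<bar>a - b\<bar> * g) [1..<Suc (Suc N)] B"
    unfolding list by simp
qed

section \<open>Passage between list elimination and the sets \<open>CP\<close>\<close>

lemma CP_of_real:
  assumes cp: "comp_piv [1..<Suc m] B" and "m \<ge> 1"
    and BS: "\<And>i j. B i j \<in> S"
  shows "(\<lambda>i j. complex_of_real (B i j)) \<in> CP m (complex_of_real ` S)"
proof -
  let ?B = "\<lambda>i j. complex_of_real (B i j)"
  have ge: "ge_iter ?B (k - 1) i j = of_real (schur_iter B (k - 1) i j)"
    if "k \<in> {1..m}" "i \<in> {k..m}" "j \<in> {k..m}" for k i j
    using that by (intro ge_iter_of_real[of m]) auto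
  have nz: "\<forall>k\<in>{1..m}. ge_iter ?B (k - 1) k k \<noteq> 0"
    using ge comp_piv_schur_iter_bound(1)[OF cp] by fastforce
  have "cmod (ge ?B k i j) \<le> cmod (ge ?B k k k)"
    if "k \<in> {1..m}" "i \<in> {k..m}" "j \<in> {k..m}" for k i j
    using comp_piv_schur_iter_bound(2)[OF cp that] ge[OF that] ge[of k k k] that
    by (simp add: ge_def)
  then show ?thesis
    using BS nz invertible_n_if_pivots[OF nz] by (auto simp: CP_def ge_defined_def ge_def)
qed

lemma growth_factor_ge:
  assumes piv: "pivot_ge h [1..<Suc m] B" and "m \<ge> 1"
    and max: "\<And>i j. \<bar>B i j\<bar> \<le> M" and "B 1 1 \<noteq> 0" "0 \<le> h"
  shows "h / M \<le> growth_factor m (\<lambda>i j. complex_of_real (B i j))"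
proof -
  let ?B = "\<lambda>i j. complex_of_real (B i j)"
  let ?X = "{cmod (ge ?B k i j) | k i j. 1 \<le> k \<and> k \<le> m \<and> k \<le> i \<and> i \<le> m \<and> k \<le> j \<and> j \<le> m}"
  let ?Y = "{cmod (?B i j) | i j. i \<in> {1..m} \<and> j \<in> {1..m}}"
  obtain k where k: "k \<in> {1..m}" "h \<le> \<bar>schur_iter B (k - 1) k k\<bar>"
    using piv pivot_ge_schur_iter[of h 0 m B] by auto
  have "ge ?B k k k = of_real (schur_iter B (k - 1) k k)"
    unfolding ge_def using k(1) by (intro ge_iter_of_real[of m]) auto
  then have "h \<le> cmod (ge ?B k k k)" using k(2) by simp
  moreover have "finite ?X"
  proof (rule finite_subset)
    show "?X \<subseteq> (\<lambda>(k, i, j). cmod (ge ?B k i j)) ` ({1..m} \<times> {1..m} \<times> {1..m})" by force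
  qed simp
  then have "cmod (ge ?B k k k) \<le> Max ?X" using k(1) by (intro Max_ge) auto
  ultimately have num: "h \<le> Max ?X" by simp
  have finY: "finite ?Y"
  proof (rule finite_subset)
    show "?Y \<subseteq> (\<lambda>(i, j). cmod (?B i j)) ` ({1..m} \<times> {1..m})" by force
  qed simp
  have Y11: "cmod (?B 1 1) \<in> ?Y" using \<open>m \<ge> 1\<close> by force
  have "0 < cmod (?B 1 1)" using \<open>B 1 1 \<noteq> 0\<close> by simp
  also have "\<dots> \<le> Max ?Y" using finY Y11 by (rule Max_ge)
  finally have pos: "0 < Max ?Y" .
  have "Max ?Y \<le> M" using finY Y11 max by (intro Max.boundedI) auto
  then show ?thesis unfolding growth_factor_def
    using num pos \<open>0 \<le> h\<close> by (intro frac_le) auto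
qed

text \<open>\<open>K\<close> is the index of a largest pivot and \<open>l \<le> K\<close> that of a smallest pivot up to \<open>K\<close>: starting at
  step \<open>l\<close> and stopping at step \<open>K\<close> does not decrease the growth.\<close>

lemma CP_real_reduction:
  assumes A: "A \<in> CP n (range complex_of_real)" and "n \<ge> 1"
  obtains R l K c h where "1 \<le> l" "l \<le> K" "K \<le> n" "0 < c"
    "strict_piv 1 c [l..<Suc K] (schur_iter R (l - 1))"
    "pivot_ge (c * h) [l..<Suc K] (schur_iter R (l - 1))"
    "\<And>i j. i \<in> {l..K} \<Longrightarrow> j \<in> {l..K} \<Longrightarrow> \<bar>schur_iter R (l - 1) i j\<bar> \<le> c"
    "growth_factor n A \<le> h" "1 \<le> h"
proof -
  define R where "R = (\<lambda>i j. Re (A i j))"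
  have real: "A i j = of_real (R i j)" if "i \<in> {1..n}" "j \<in> {1..n}" for i j
  proof -
    have "A i j \<in> range complex_of_real" using A that by (auto simp: CP_def)
    then show ?thesis by (auto simp: R_def)
  qed
  have ge: "ge A k i j = of_real (schur_iter R (k - 1) i j)"
    if "k \<in> {1..n}" "i \<in> {1..n}" "j \<in> {1..n}" for k i j
    unfolding ge_def using that real by (intro ge_iter_of_real[of n]) auto
  define p where "p k = \<bar>schur_iter R (k - 1) k k\<bar>" for k
  have bound: "\<bar>schur_iter R (k - 1) i j\<bar> \<le> p k"
    if "k \<in> {1..n}" "i \<in> {k..n}" "j \<in> {k..n}" for k i j
  proof -
    have "cmod (ge A k i j) \<le> cmod (ge A k k k)" using A that by (auto simp: CP_def)
    then show ?thesis using ge[of k i j] ge[of k k k] that by (simp add: p_def)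
  qed
  \<comment> \<open>For \<open>n = 1\<close> the condition \<open>ge_defined\<close> is vacuous, so
    this has to come from invertibility: a zero first pivot forces all entries to vanish.\<close>
  have p1: "0 < p 1"
  proof (rule ccontr)
    assume "\<not> 0 < p 1"
    then have "p 1 = 0" by (simp add: p_def)
    then have zero: "A i j = 0" if "i \<in> {1..n}" "j \<in> {1..n}" for i j
      using bound[of 1 i j] real[OF that] that \<open>n \<ge> 1\<close> by simp
    have prod0: "(\<Prod>i\<in>{1..n}. A i (q i)) = 0" if "q permutes {1..n}" for q
      using zero permutes_in_image[OF that, of 1] \<open>n \<ge> 1\<close>
      by (intro prod_zero bexI[of _ 1]) auto
    have "det_n n A = 0"
      unfolding det_n_def by (intro sum.neutral ballI) (simp only: mem_Collect_eq prod0 mult_zero_right)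
    then show False using A by (simp add: CP_def invertible_n_def)
  qed
  have "Max (p ` {1..n}) \<in> p ` {1..n}" using \<open>n \<ge> 1\<close> by (intro Max_in) auto
  then obtain K where K: "K \<in> {1..n}" "p K = Max (p ` {1..n})" by auto
  then have pK: "p k \<le> p K" if "k \<in> {1..n}" for k using that by simp
  have "Min (p ` {1..K}) \<in> p ` {1..K}" using K by (intro Min_in) auto
  then obtain l where l: "l \<in> {1..K}" "p l = Min (p ` {1..K})" by auto
  then have pl: "p l \<le> p k" if "k \<in> {1..K}" for k using that by simp
  have "0 < p K" using p1 pK[of 1] \<open>n \<ge> 1\<close> by simp
  \<comment> \<open>\<open>ge_defined\<close> is silent about pivot \<open>n\<close>. If
    \<open>l = n\<close>, then \<open>l = K\<close>, and the largest pivot is at least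
    \<open>p 1\<close>.\<close>
  have c: "0 < p l"
  proof (cases "l = n")
    case True
    then have "l = K" using l K by simp
    then show ?thesis using \<open>0 < p K\<close> by simp
  next
    case False
    then have "l \<in> {1..n - 1}" using l K by auto
    then have "ge A l l l \<noteq> 0" using A by (auto simp: CP_def ge_defined_def)
    then show ?thesis using ge[of l l l] l(1) K(1) by (simp add: p_def)
  qed
  have Suc: "Suc (l - 1) = l" using l by simp
  show ?thesis
  \<comment> \<open>All entries at step \<open>l\<close> are at most \<open>p l\<close>, so the
    growth from there to step \<open>K\<close> is \<open>p K / p l\<close>. It dominates the growth
    of \<open>A\<close>, because \<open>p l \<le> p 1\<close> and \<open>p 1\<close> is the modulus
    of an entry of \<open>A\<close>.\<close>
  proof (rule that[of l K "p l" R "p K / p l"])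
    show "strict_piv 1 (p l) [l..<Suc K] (schur_iter R (l - 1))"
    proof (rule strict_piv_schur_iter[of "l - 1" K R "p l", unfolded Suc])
      fix k assume "k \<in> {l..K}"
      then show "p l \<le> \<bar>schur_iter R (k - 1) k k\<bar>" using pl[of k] l by (simp add: p_def)
    next
      fix k i j assume "k \<in> {l..K}" "i \<in> {k..K}" "j \<in> {k..K}"
      then show "\<bar>schur_iter R (k - 1) i j\<bar> \<le> \<bar>schur_iter R (k - 1) k k\<bar>"
        using bound[of k i j] l K by (simp add: p_def)
    qed
    have "\<exists>k\<in>{l..K}. p K \<le> \<bar>schur_iter R (k - 1) k k\<bar>"
      using l by (intro bexI[of _ K]) (auto simp: p_def)
    then show "pivot_ge (p l * (p K / p l)) [l..<Suc K] (schur_iter R (l - 1))"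
      using pivot_ge_schur_iter[of "p K" "l - 1" K R, unfolded Suc] c by simp
    show "\<bar>schur_iter R (l - 1) i j\<bar> \<le> p l" if "i \<in> {l..K}" "j \<in> {l..K}" for i j
      using bound[of l i j] that l K by simp
    show "1 \<le> p K / p l" using c pl[of K] l by simp
    let ?X = "{cmod (ge A k i j) | k i j. 1 \<le> k \<and> k \<le> n \<and> k \<le> i \<and> i \<le> n \<and> k \<le> j \<and> j \<le> n}"
    let ?Y = "{cmod (A i j) | i j. i \<in> {1..n} \<and> j \<in> {1..n}}"
    have "finite ?X"
    proof (rule finite_subset)
      show "?X \<subseteq> (\<lambda>(k, i, j). cmod (ge A k i j)) ` ({1..n} \<times> {1..n} \<times> {1..n})" by force
    qed simp
    moreover have "?X \<noteq> {}" using \<open>n \<ge> 1\<close> by auto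
    moreover have "cmod (ge A k i j) \<le> p K"
      if "1 \<le> k \<and> k \<le> n \<and> k \<le> i \<and> i \<le> n \<and> k \<le> j \<and> j \<le> n" for k i j
      using bound[of k i j] pK[of k] ge[of k i j] that by simp
    ultimately have num: "Max ?X \<le> p K" by (intro Max.boundedI) auto
    have "finite ?Y"
    proof (rule finite_subset)
      show "?Y \<subseteq> (\<lambda>(i, j). cmod (A i j)) ` ({1..n} \<times> {1..n})" by force
    qed simp
    moreover have "cmod (A 1 1) \<in> ?Y" using \<open>n \<ge> 1\<close> by force
    ultimately have "cmod (A 1 1) \<le> Max ?Y" by (rule Max_ge)
    moreover have "cmod (A 1 1) = p 1" using real[of 1 1] \<open>n \<ge> 1\<close> by (simp add: p_def)
    ultimately have "p l \<le> Max ?Y" using pl[of 1] K by simp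
    then show "growth_factor n A \<le> p K / p l"
      unfolding growth_factor_def using num c \<open>0 < p K\<close> by (intro frac_le) auto
  qed (use l K c in auto)
qed

section \<open>The choice of constants and the growth bounds\<close>

lemma exists_binary_matrix_CP:
  assumes A: "A \<in> CP n (range complex_of_real)" and n: "n \<ge> 1"
    and N: "4 * n * (3 * n + 1) \<le> N"
  shows "\<exists>h W. 1 \<le> h \<and> growth_factor n A \<le> h \<and> (\<forall>i j. W i j \<in> {0, 1})
    \<and> comp_piv [1..<Suc N] W \<and> pivot_ge (h / 2) [1..<Suc N] W"
proof -
  obtain R l K c h where *: "1 \<le> l" "l \<le> K" "K \<le> n" "0 < c"
    "strict_piv 1 c [l..<Suc K] (schur_iter R (l - 1))"
    "pivot_ge (c * h) [l..<Suc K] (schur_iter R (l - 1))"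
    "\<And>i j. i \<in> {l..K} \<Longrightarrow> j \<in> {l..K} \<Longrightarrow> \<bar>schur_iter R (l - 1) i j\<bar> \<le> c"
    "growth_factor n A \<le> h" "1 \<le> h"
    using CP_real_reduction[OF A n] by metis
  define M where "M = schur_iter R (l - 1)"
  define bs where "bs = [l..<Suc K]"
  \<comment> \<open>Damping row and column \<open>i\<close> by \<open>s ^ (i - l)\<close> makes every pivot dominate strictly, at the price
    of a factor at most \<open>1 / \<delta> < 2\<close> in the growth.\<close>
  define s where "s = 1 - 1 / (4 * real n)"
  define \<delta> where "\<delta> = 1 / 2 + 1 / (2 * real n)"
  define d where "d i = s ^ (i - l)" for i
  define T where "T = (\<lambda>i j. 1 / c * d i * d j * M i j)"
  have set_bs: "set bs = {l..K}" by (auto simp: bs_def)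
  have len: "length bs \<le> n" using * by (simp add: bs_def del: upt_Suc)
  have n1: "1 \<le> real n" using n by simp
  have s: "0 < s" "s \<le> 1" using n1 by (auto simp: s_def field_simps)
  have d: "0 < d i" "d i \<le> 1" for i using s by (auto simp: d_def power_le_one)
  have d2: "\<delta> \<le> (d i)\<^sup>2" if "i \<in> set bs" for i
  proof -
    \<comment> \<open>The smallest squared weight is at least \<open>s ^ (2 * n - 2)\<close>, and
      \<open>\<delta>\<close> is exactly the Bernoulli lower bound for it.\<close>
    have "\<delta> = 1 + real (2 * n - 2) * (- 1 / (4 * real n))"
      using n by (simp add: \<delta>_def field_simps of_nat_diff)
    also have "\<dots> \<le> (1 + (- 1 / (4 * real n))) ^ (2 * n - 2)"
      using n1 by (intro Bernoulli_inequality) (simp add: field_simps)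
    also have "\<dots> = s ^ (2 * n - 2)" by (simp add: s_def)
    also have "\<dots> \<le> s ^ ((i - l) * 2)"
      using that * s by (intro power_decreasing) (auto simp: set_bs)
    finally show ?thesis by (simp add: d_def power_mult)
  qed
  have strict: "strict_piv s \<delta> bs T" unfolding T_def
  proof (rule strict_piv_diag_scale[where c = c])
    show "strict_piv 1 c bs M" using *(5) by (simp add: bs_def M_def)
    show "\<delta> \<le> 1 / c * (d i)\<^sup>2 * c" if "i \<in> set bs" for i using d2[OF that] \<open>0 < c\<close> by simp
    have "d y \<le> s * d x" if "x \<in> set bs" "x < y" for x y
    proof -
      have "d y \<le> s ^ Suc (x - l)"
        unfolding d_def using that s by (intro power_decreasing) (auto simp: set_bs)
      then show ?thesis by (simp add: d_def)
    qed
    moreover have "sorted_wrt (<) bs" by (simp add: bs_def del: upt_Suc)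
    ultimately show "sorted_wrt (\<lambda>x y. d y \<le> s * d x) bs"
      by (auto intro: sorted_wrt_mono_rel)
  qed (use s d \<open>0 < c\<close> in auto)
  have piv: "pivot_ge (\<delta> * h) bs T"
  proof -
    have "pivot_ge (\<delta> / c * (c * h)) bs T" unfolding T_def
    proof (rule pivot_ge_diag_scale)
      show "pivot_ge (c * h) bs M" using *(6) by (simp add: bs_def M_def)
      show "\<delta> / c \<le> 1 / c * (d i)\<^sup>2" if "i \<in> set bs" for i
        using d2[OF that] \<open>0 < c\<close> by (simp add: divide_right_mono)
    qed (use \<open>0 < c\<close> \<open>1 \<le> h\<close> d in auto)
    then show ?thesis using \<open>0 < c\<close> by simp
  qed
  have le1: "\<bar>T i j\<bar> \<le> 1" if "i \<in> set bs" "j \<in> set bs" for i j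
  proof -
    have "d i * d j * \<bar>M i j\<bar> \<le> 1 * 1 * c"
      using d[of i] d[of j] *(7)[of i j] that by (intro mult_mono) (auto simp: set_bs M_def less_imp_le)
    then show ?thesis using d[of i] d[of j] \<open>0 < c\<close> by (simp add: T_def abs_mult field_simps)
  qed
  \<comment> \<open>Of \<open>2 ^ (4 * n) = 4 ^ n * 4 ^ n\<close>, one factor pays for the
    amplification over at most \<open>n\<close> steps; the other, with the extra digit, pushes the
    remaining error below \<open>1 / (4 * real n)\<close>.\<close>
  have err: "4 ^ length bs / 2 ^ (4 * n + 1) \<le> 1 / (4 * real n)"
  proof -
    have e: "(2::real) ^ (4 * n + 1) = 4 ^ n * (2 * 4 ^ n)"
      by (simp add: power_mult flip: power_mult_distrib)
    have "4 ^ length bs / 2 ^ (4 * n + 1) \<le> 4 ^ n / (2 ^ (4 * n + 1) :: real)"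
      using len by (intro divide_right_mono power_increasing) auto
    also have "\<dots> = 1 / (2 * 4 ^ n)" unfolding e by simp
    also have "\<dots> \<le> 1 / (4 * real n)"
    proof -
      have "1 + real n * 3 \<le> (1 + 3) ^ n" by (intro Bernoulli_inequality) simp
      then have "4 * real n \<le> 2 * 4 ^ n" using n1 by simp
      then show ?thesis using n1 by (intro divide_left_mono) auto
    qed
    finally show ?thesis .
  qed
  \<comment> \<open>The right-hand side is \<open>1 / (4 * real n)\<close> times
    \<open>1 + 1 / real n\<close>.\<close>
  have "1 / (4 * real n) \<le> 2 * (1 - s) * \<delta>"
    using n1 by (simp add: s_def \<delta>_def field_simps)
  then have prec: "4 ^ length bs / 2 ^ (4 * n + 1) \<le> 2 * (1 - s) * \<delta>" using err by linarith
  have "3 * (4 * n + 1) * length bs + length bs = length bs * (4 * (3 * n + 1))"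
    by (simp add: algebra_simps)
  also have "\<dots> \<le> n * (4 * (3 * n + 1))" using len by (rule mult_le_mono1)
  also have "\<dots> \<le> N" using N by (simp add: algebra_simps)
  finally have NN: "3 * (4 * n + 1) * length bs + length bs \<le> N" .
  have \<delta>pos: "0 < \<delta>" using n1 by (simp add: \<delta>_def add_pos_pos)
  have dist: "distinct bs" by (simp add: bs_def del: upt_Suc)
  obtain W where W: "\<forall>i j. W i j \<in> {0, 1}" "comp_piv [1..<Suc N] W"
      "pivot_ge (\<delta> * h - 4 ^ length bs / 2 ^ (4 * n + 1)) [1..<Suc N] W"
    using exists_binary_matrix[OF strict piv dist le1 s \<delta>pos prec NN] by blast
  \<comment> \<open>The surplus of \<open>\<delta>\<close> over 1/2 is
    \<open>1 / (2 * real n)\<close>; as \<open>h \<ge> 1\<close>, it pays for the truncation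
    error.\<close>
  have "h / 2 \<le> \<delta> * h - 4 ^ length bs / 2 ^ (4 * n + 1)"
  proof -
    have "1 / (4 * real n) * 1 \<le> 1 / (2 * real n) * h"
      using n1 \<open>1 \<le> h\<close> by (intro mult_mono) (auto simp: field_simps)
    then have "h / 2 \<le> \<delta> * h - 1 / (4 * real n)" by (simp add: \<delta>_def algebra_simps)
    then show ?thesis using err by linarith
  qed
  then show ?thesis using W *(8,9) pivot_ge_mono by blast
qed

text \<open>The border adds one dimension, hence \<open>Suc N\<close>. The denominator is the
  supremum over all of \<open>S\<close>, which bounds every entry whichever pair is used.\<close>

lemma growth_sup_two_values:
  assumes "bounded S" "a \<in> S" "b \<in> S" "a \<noteq> b" "\<bar>a\<bar> \<le> \<bar>b\<bar>" "0 \<le> h"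
    and W: "\<And>i j. W i j \<in> {0, 1}" "comp_piv [1..<Suc N] W" "pivot_ge (h / 2) [1..<Suc N] W"
  shows "ereal (\<bar>a - b\<bar> * h / (2 * (SUP s\<in>S. \<bar>s\<bar>)))
    \<le> growth_sup (Suc N) (CP (Suc N) (complex_of_real ` S))"
proof -
  let ?M = "SUP s\<in>S. \<bar>s\<bar>"
  define B where "B = (\<lambda>i j. if i = 1 \<or> j = 1 then b else b + (a - b) * W (i - 1) (j - 1))"
  have B: "comp_piv [1..<Suc (Suc N)] B" "pivot_ge (\<bar>a - b\<bar> * (h / 2)) [1..<Suc (Suc N)] B"
    "B i j \<in> {a, b}" for i j
    unfolding B_def using comp_piv_border[OF W \<open>a \<noteq> b\<close> \<open>\<bar>a\<bar> \<le> \<bar>b\<bar>\<close>] by blast+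
  have "bdd_above ((\<lambda>s. \<bar>s\<bar>) ` S)"
    using \<open>bounded S\<close> by (auto simp: bounded_iff bdd_above_def)
  then have "\<bar>s\<bar> \<le> ?M" if "s \<in> S" for s using that by (intro cSUP_upper)
  then have max: "\<bar>B i j\<bar> \<le> ?M" for i j using B(3)[of i j] assms(2,3) by auto
  have "B 1 1 \<noteq> 0" using assms(4,5) by (auto simp: B_def)
  then have "\<bar>a - b\<bar> * (h / 2) / ?M \<le> growth_factor (Suc N) (\<lambda>i j. of_real (B i j))"
    using \<open>0 \<le> h\<close> by (intro growth_factor_ge[OF B(2) _ max]) auto
  moreover have "(\<lambda>i j. complex_of_real (B i j)) \<in> CP (Suc N) (complex_of_real ` S)"
  proof (rule CP_of_real[OF B(1)])
    show "B i j \<in> S" for i j using B(3)[of i j] assms(2,3) by auto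
  qed simp
  ultimately show ?thesis
    unfolding growth_sup_def by (intro SUP_upper2) (auto simp: mult.commute mult.left_commute)
qed

theorem mainTheorem7:
  fixes S :: "real set" and n m :: nat
  assumes "bounded S" and "\<exists>s\<in>S. \<exists>s'\<in>S. s \<noteq> s'"
    and "n \<ge> 1" and "int m > 4 * int n * (3 * int n + 1)"
  shows "growth_sup m (CP m (complex_of_real ` S))
           \<ge> ereal (diameter S / (2 * (SUP s\<in>S. \<bar>s\<bar>))) * growth_sup n (CP n (range complex_of_real))"
proof -
  let ?M = "SUP s\<in>S. \<bar>s\<bar>" and ?X = "CP n (range complex_of_real)"
  let ?L = "growth_sup m (CP m (complex_of_real ` S))"
  have "int (4 * n * (3 * n + 1)) < int m" using assms(4) by (simp add: algebra_simps)
  then have "4 * n * (3 * n + 1) < m" by linarith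
  \<comment> \<open>The strict inequality leaves room for the border row and column.\<close>
  then obtain N where N: "m = Suc N" "4 * n * (3 * n + 1) \<le> N" by (cases m) auto
  obtain s s' where s: "s \<in> S" "s' \<in> S" "s \<noteq> s'" using assms(2) by blast
  have "bdd_above ((\<lambda>s. \<bar>s\<bar>) ` S)"
    using \<open>bounded S\<close> by (auto simp: bounded_iff bdd_above_def)
  then have "\<bar>s\<bar> \<le> ?M" "\<bar>s'\<bar> \<le> ?M" using s by (auto intro: cSUP_upper)
  then have M: "0 < ?M" using s(3) by linarith
  have "\<bar>s - s'\<bar> \<le> diameter S"
    using diameter_bounded_bound[OF \<open>bounded S\<close> s(1,2)] by (simp add: dist_real_def)
  then have c: "0 < diameter S / (2 * ?M)" using s(3) M by simp
  have le: "ereal (diameter S / (2 * ?M) * growth_factor n A) \<le> ?L" if A: "A \<in> ?X" for A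
  proof -
    obtain h W where h: "1 \<le> h" "growth_factor n A \<le> h"
      and W: "\<And>i j. W i j \<in> {0, 1}" "comp_piv [1..<Suc N] W" "pivot_ge (h / 2) [1..<Suc N] W"
      using exists_binary_matrix_CP[OF A \<open>n \<ge> 1\<close> N(2)] by blast
    have pair: "ereal (\<bar>a - b\<bar> * h / (2 * ?M)) \<le> ?L" if ab: "a \<in> S" "b \<in> S" "a \<noteq> b" for a b
    proof (cases "\<bar>a\<bar> \<le> \<bar>b\<bar>")
      case True
      then show ?thesis
        using growth_sup_two_values[OF \<open>bounded S\<close> ab True _ W] h(1) N(1) by simp
    next
      case False
      then show ?thesis
        using growth_sup_two_values[OF \<open>bounded S\<close> ab(2,1) ab(3)[symmetric] _ _ W] h(1) N(1)
        by (simp add: abs_minus_commute)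
    qed
    show ?thesis
    \<comment> \<open>Passing from pairs to the diameter divides by \<open>h\<close> and so needs a
      real bound. An infinite supremum is harmless, and minus infinity is excluded by the pair
      \<open>s\<close>, \<open>s'\<close>.\<close>
    proof (cases ?L)
      case (real L)
      have L: "\<bar>a - b\<bar> * h / (2 * ?M) \<le> L" if "a \<in> S" "b \<in> S" for a b
      \<comment> \<open>Equal elements give no matrix; here \<open>L \<ge> 0\<close> is needed, and
        a distinct pair supplies it.\<close>
      proof (cases "a = b")
        case True
        have "0 \<le> \<bar>s - s'\<bar> * h / (2 * ?M)" using M h(1) by simp
        also have "\<dots> \<le> L" using pair[OF s] real by simp
        finally show ?thesis using True by simp
      qed (use pair[OF that] real in simp)
      have "diameter S \<le> L * (2 * ?M) / h"
      proof (rule diameter_le)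
        show "S \<noteq> {} \<or> 0 \<le> L * (2 * ?M) / h" using s by auto
        show "norm (a - b) \<le> L * (2 * ?M) / h" if "a \<in> S" "b \<in> S" for a b
          using L[OF that] M h(1) by (simp add: field_simps)
      qed
      then have "diameter S / (2 * ?M) * h \<le> L" using M h(1) by (simp add: field_simps)
      moreover have "diameter S / (2 * ?M) * growth_factor n A \<le> diameter S / (2 * ?M) * h"
        using h(2) c by (intro mult_left_mono) auto
      ultimately show ?thesis using real by simp
    next
      case MInf
      then show ?thesis using pair[OF s] by simp
    qed simp
  qed
  show ?thesis
  proof (cases "?X = {}")
    case True
    then have empty: "growth_sup n ?X = - \<infinity>" by (simp add: growth_sup_def bot_ereal_def)
    have neg: "ereal r * - \<infinity> = - \<infinity>" if "0 < r" for r using that by simp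
    show ?thesis unfolding empty neg[OF c] by simp
  next
    case False
    have "growth_sup n ?X \<le> ?L / ereal (diameter S / (2 * ?M))"
      unfolding growth_sup_def[of n]
    proof (rule SUP_least)
      fix A assume "A \<in> ?X"
      then show "ereal (growth_factor n A) \<le> ?L / ereal (diameter S / (2 * ?M))"
        using le[of A] c by (simp add: ereal_le_divide_pos)
    qed
    then show ?thesis using c by (simp add: ereal_le_divide_pos)
  qed
qed

end
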